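(* Let $f:\mathbb{R}^n\to\mathbb{R}$ be a strictly convex, twice differentiable function that is bounded from below and attains its minimum at some $x^*\in\mathbb{R}^n$, and suppose $f$ is strongly self-concordant with constant $M>0$. Suppose the sequence $(x_k)_{k\in\mathbb{N}}$ in $\mathbb{R}^n$ is generated by the pure Newton method $x_{k+1}=x_k-\nabla^2 f(x_k)^{-1}\nabla f(x_k)$. Then for every $k\in\mathbb{N}$ with $\lambda(x_k)<\frac{2}{M}$, $$\lambda(x_{k+1})\le \frac{M\sqrt{1+M\lambda(x_k)}}{2}\,\lambda(x_k)^2\le \left(1+\frac{M\lambda(x_k)}{2}\right)\frac{M\lambda(x_k)^2}{2}\le \frac{1}{\left(1-\frac{M}{2}\lambda(x_k)\right)^2}\,\frac{M\lambda(x_k)^2}{2}.$$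
   Context: For symmetric matrices, $A\preceq B$ means $B-A$ is positive semidefinite. The local norm at $z\in\mathbb{R}^n$ is $\|y\|_z=(y^T\nabla^2 f(z)y)^{1/2}$. The function $f$ is strongly self-concordant with constant $M>0$ if for all $x,y,z,w\in\mathbb{R}^n$, $\nabla^2 f(y)-\nabla^2 f(x)\preceq M\|x-y\|_z\nabla^2 f(w)$. Hessians are taken to be invertible (positive definite), so that the local norms and their duals are well defined. The Newton decrement is $\lambda(x)=[\nabla f(x)^T\nabla^2 f(x)^{-1}\nabla f(x)]^{1/2}$. *)

theory Defs
  imports "HOL-Analysis.Analysis"
begin

definition gradient :: "(real^'n \<Rightarrow> real) \<Rightarrow> real^'n \<Rightarrow> real^'n" where
  "gradient f x = (THE g. GDERIV f x :> g)"

definition hessian :: "(real^'n \<Rightarrow> real) \<Rightarrow> real^'n \<Rightarrow> real^'n^'n" where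
  "hessian f x = jacobian (gradient f) (at x)"

text \<open>Differentiability is Frechet differentiability throughout; the Hessian is not assumed
  to be continuous.\<close>

definition twice_differentiable :: "(real^'n \<Rightarrow> real) \<Rightarrow> bool" where
  "twice_differentiable f \<longleftrightarrow>
     (\<forall>x. f differentiable (at x)) \<and> (\<forall>x. gradient f differentiable (at x))"

definition strictly_convex :: "('a::real_vector \<Rightarrow> real) \<Rightarrow> bool" where
  "strictly_convex f \<longleftrightarrow>
     (\<forall>x y u v. x \<noteq> y \<longrightarrow> u > 0 \<longrightarrow> v > 0 \<longrightarrow> u + v = 1 \<longrightarrow>
        f (u *\<^sub>R x + v *\<^sub>R y) < u * f x + v * f y)"

text \<open>Definiteness is a notion for symmetric matrices, so symmetry is part of the definitions.
  For Hessians of twice differentiable functions, and for linear combinations of these,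
  symmetry holds automatically.\<close>

definition positive_semidefinite :: "real^'n^'n \<Rightarrow> bool" where
  "positive_semidefinite A \<longleftrightarrow> transpose A = A \<and> (\<forall>v. 0 \<le> v \<bullet> (A *v v))"

definition positive_definite :: "real^'n^'n \<Rightarrow> bool" where
  "positive_definite A \<longleftrightarrow> transpose A = A \<and> (\<forall>v. v \<noteq> 0 \<longrightarrow> 0 < v \<bullet> (A *v v))"

definition loewner_le :: "real^'n^'n \<Rightarrow> real^'n^'n \<Rightarrow> bool" (infix \<open>\<preceq>\<close> 50) where
  "A \<preceq> B \<longleftrightarrow> positive_semidefinite (B - A)"

definition local_norm :: "(real^'n \<Rightarrow> real) \<Rightarrow> real^'n \<Rightarrow> real^'n \<Rightarrow> real" where
  "local_norm f z y = sqrt (y \<bullet> (hessian f z *v y))"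

definition strongly_self_concordant :: "real \<Rightarrow> (real^'n \<Rightarrow> real) \<Rightarrow> bool" where
  "strongly_self_concordant M f \<longleftrightarrow>
     (\<forall>x y z w. hessian f y - hessian f x \<preceq> (M * local_norm f z (x - y)) *\<^sub>R hessian f w)"

definition newton_decrement :: "(real^'n \<Rightarrow> real) \<Rightarrow> real^'n \<Rightarrow> real" where
  "newton_decrement f x = sqrt (gradient f x \<bullet> (matrix_inv (hessian f x) *v gradient f x))"

definition newton_sequence :: "(real^'n \<Rightarrow> real) \<Rightarrow> (nat \<Rightarrow> real^'n) \<Rightarrow> bool" where
  "newton_sequence f x \<longleftrightarrow>
     (\<forall>k. x (Suc k) = x k - matrix_inv (hessian f (x k)) *v gradient f (x k))"

end

theory Submission
  imports Defs
begin

text \<open>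
  Let \<open>d\<close> be the Newton step at \<open>x\<close>, so that \<open>H(x) d = - \<nabla>f(x)\<close> and \<open>\<lambda>(x)\<close> is the local norm
  of \<open>d\<close> at \<open>x\<close>. The new gradient is then exactly the linearisation error
  \<open>\<nabla>f(x+d) - \<nabla>f(x) - H(x) d\<close>, whose pairing with a vector \<open>v\<close> grows along the segment at the rate
  \<open>v \<bullet> (H(x+td) - H(x)) d\<close>. Strong self-concordance bounds the quadratic form of
  \<open>H(x+td) - H(x)\<close> from both sides by \<open>t M \<lambda>(x)\<close> times that of the Hessian at a point \<open>w\<close> that
  may be chosen freely, and a Cauchy-Schwarz argument turns this into the bilinear bound
  \<open>t M \<lambda>(x) \<parallel>v\<parallel>\<^sub>w \<parallel>d\<parallel>\<^sub>w\<close>. Integrating over \<open>t\<close> gives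
  \<open>v \<bullet> \<nabla>f(x+d) \<le> M/2 \<lambda>(x) \<parallel>v\<parallel>\<^sub>w \<parallel>d\<parallel>\<^sub>w\<close> (lemma \<open>gradient_linearisation_error\<close>).

  The decisive choice is \<open>w = x+d\<close>. With \<open>v = H(x+d)\<inverse> \<nabla>f(x+d)\<close> the left-hand side is
  \<open>\<lambda>(x+d)\<^sup>2\<close> and \<open>\<parallel>v\<parallel>\<^sub>w = \<lambda>(x+d)\<close>, so one factor cancels. What remains is \<open>\<parallel>d\<parallel>\<^sub>w\<close>, the Newton
  step measured at its end point, and self-concordance once more bounds it by
  \<open>sqrt (1 + M \<lambda>(x)) \<lambda>(x)\<close>; this is the source of the square root in the rate. The other two
  inequalities of the chain are elementary facts about real numbers.
\<close>

lemma positive_definite_matrix_inv_mult: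
  fixes A :: "real^'n^'n"
  assumes "positive_definite A"
  shows "A *v (matrix_inv A *v g) = g"
proof -
  have "v = 0" if "A *v v = 0" for v
    using assms that unfolding positive_definite_def by fastforce
  then have "invertible A"
    using invertible_left_inverse matrix_left_invertible_ker by blast
  then have "A ** matrix_inv A = mat 1"
    unfolding matrix_inv_def invertible_def by (rule someI2_ex) simp
  then show ?thesis
    by (simp add: matrix_vector_mul_assoc)
qed

lemma symmetric_matrix_inner_commute:
  fixes E :: "real^'n^'n"
  assumes "transpose E = E"
  shows "u \<bullet> (E *v v) = v \<bullet> (E *v u)"
proof -
  have "u \<bullet> (E *v v) = (transpose E *v u) \<bullet> v"
    by (simp only: transpose_matrix_vector dot_lmul_matrix)
  then show ?thesis
    by (simp only: assms inner_commute)
qed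

text \<open>Polarisation bounds \<open>u \<bullet> E v\<close> by the arithmetic mean of the two \<open>A\<close>-forms; for vectors of
  unit length in the \<open>A\<close>-norm this mean equals the geometric one, and the general case follows by
  scaling.\<close>

lemma Cauchy_Schwarz_dominated_form:
  fixes A E :: "real^'n^'n"
  assumes A: "positive_definite A" and E: "transpose E = E"
    and dom: "\<And>v. \<bar>v \<bullet> (E *v v)\<bar> \<le> c * (v \<bullet> (A *v v))"
  shows "u \<bullet> (E *v v) \<le> c * sqrt (u \<bullet> (A *v u)) * sqrt (v \<bullet> (A *v v))"
proof (cases "u = 0 \<or> v = 0")
  case True
  then show ?thesis by auto
next
  case False
  have symA: "transpose A = A"
    using A by (simp add: positive_definite_def)
  have mean: "2 * (p \<bullet> (E *v q)) \<le> c * (p \<bullet> (A *v p)) + c * (q \<bullet> (A *v q))" for p q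
  proof -
    have "4 * (p \<bullet> (E *v q)) = (p + q) \<bullet> (E *v (p + q)) - (p - q) \<bullet> (E *v (p - q))"
      using symmetric_matrix_inner_commute[OF E, of p q]
      by (simp add: algebra_simps matrix_vector_right_distrib matrix_vector_mult_diff_distrib)
    also have "\<dots> \<le> c * ((p + q) \<bullet> (A *v (p + q))) + c * ((p - q) \<bullet> (A *v (p - q)))"
      using dom[of "p + q"] dom[of "p - q"] by linarith
    also have "\<dots> = 2 * (c * (p \<bullet> (A *v p)) + c * (q \<bullet> (A *v q)))"
      by (simp add: algebra_simps matrix_vector_right_distrib matrix_vector_mult_diff_distrib)
    finally show ?thesis by simp
  qed
  define a where "a = sqrt (u \<bullet> (A *v u))"
  define b where "b = sqrt (v \<bullet> (A *v v))"
  have pos: "u \<bullet> (A *v u) > 0" "v \<bullet> (A *v v) > 0"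
    using A False by (auto simp: positive_definite_def)
  then have ab: "a > 0" "b > 0" "u \<bullet> (A *v u) = a\<^sup>2" "v \<bullet> (A *v v) = b\<^sup>2"
    by (auto simp: a_def b_def)
  have "2 * (u \<bullet> (E *v v)) / (a * b) \<le> c + c"
    using mean[of "(1/a) *\<^sub>R u" "(1/b) *\<^sub>R v"] ab
    by (simp add: matrix_vector_mult_scaleR power2_eq_square field_simps)
  then have "u \<bullet> (E *v v) \<le> c * a * b"
    using ab by (simp add: field_simps)
  then show ?thesis
    by (simp add: a_def b_def)
qed

lemma local_norm_scaleR: "local_norm f z (t *\<^sub>R y) = \<bar>t\<bar> * local_norm f z y"
proof -
  have "(t *\<^sub>R y) \<bullet> (hessian f z *v (t *\<^sub>R y)) = t\<^sup>2 * (y \<bullet> (hessian f z *v y))"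
    by (simp add: matrix_vector_mult_scaleR power2_eq_square)
  then show ?thesis
    by (simp add: local_norm_def real_sqrt_mult)
qed

lemma local_norm_minus: "local_norm f z (- y) = local_norm f z y"
  using local_norm_scaleR[of f z "-1" y] by simp

lemma positive_definite_form_nonneg:
  assumes "positive_definite A"
  shows "0 \<le> y \<bullet> (A *v y)"
proof (cases "y = 0")
  case False
  then have "0 < y \<bullet> (A *v y)"
    using assms unfolding positive_definite_def by blast
  then show ?thesis by simp
qed simp

lemma local_norm_nonneg:
  assumes "positive_definite (hessian f z)"
  shows "0 \<le> local_norm f z y"
  using positive_definite_form_nonneg[OF assms] by (simp add: local_norm_def)

lemma local_norm_square:
  assumes "positive_definite (hessian f z)"
  shows "(local_norm f z y)\<^sup>2 = y \<bullet> (hessian f z *v y)"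
  using positive_definite_form_nonneg[OF assms] by (simp add: local_norm_def)

lemma newton_decrement_eq_local_norm:
  assumes "positive_definite (hessian f y)"
  shows "newton_decrement f y = local_norm f y (matrix_inv (hessian f y) *v gradient f y)"
  by (simp add: newton_decrement_def local_norm_def inner_commute
      positive_definite_matrix_inv_mult[OF assms])

lemma strongly_self_concordant_form_diff_le:
  assumes "strongly_self_concordant M f"
  shows "v \<bullet> (hessian f y *v v) - v \<bullet> (hessian f x *v v)
    \<le> M * local_norm f z (x - y) * (v \<bullet> (hessian f w *v v))"
proof -
  have "0 \<le> v \<bullet> (((M * local_norm f z (x - y)) *\<^sub>R hessian f w - (hessian f y - hessian f x)) *v v)"
    using assms
    by (auto simp: strongly_self_concordant_def loewner_le_def positive_semidefinite_def)
  then show ?thesis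
    by (simp add: matrix_vector_mult_diff_rdistrib scaleR_matrix_vector_assoc[symmetric]
        inner_diff_right)
qed

text \<open>The definition bounds \<open>H(y) - H(x)\<close> only from above; exchanging \<open>x\<close> and \<open>y\<close> gives the bound
  from below, because the local norm is even.\<close>

lemma strongly_self_concordant_abs_form_diff_le:
  assumes "strongly_self_concordant M f"
  shows "\<bar>v \<bullet> ((hessian f y - hessian f x) *v v)\<bar>
    \<le> M * local_norm f z (y - x) * (v \<bullet> (hessian f w *v v))"
  using strongly_self_concordant_form_diff_le[OF assms, of v y x z w]
    strongly_self_concordant_form_diff_le[OF assms, of v x y z w] local_norm_minus[of f z "y - x"]
  by (simp add: matrix_vector_mult_diff_rdistrib inner_diff_right)

text \<open>Subtracting the primitive \<open>C t\<^sup>2 / 2\<close> of the bound \<open>C t\<close> on the derivative of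
  \<open>t \<mapsto> v \<bullet> (\<nabla>f(x+td) - t H(x) d)\<close> leaves a function with nonpositive derivative, which is
  decreasing; this replaces an integral of the Hessian along the segment. The reference point
  \<open>w\<close> is left free, because the pairing with \<open>v\<close> becomes the decrement at the new point only in
  the local norm of that point.\<close>

lemma gradient_linearisation_error:
  fixes f :: "real^'n \<Rightarrow> real"
  assumes diff: "\<And>y. gradient f differentiable (at y)"
    and pd: "\<And>y. positive_definite (hessian f y)"
    and ssc: "strongly_self_concordant M f"
  shows "v \<bullet> (gradient f (x + d) - gradient f x - hessian f x *v d)
    \<le> M / 2 * local_norm f x d * local_norm f w v * local_norm f w d"
proof -
  define C where "C = M * local_norm f x d * local_norm f w v * local_norm f w d"
  define h where "h t = v \<bullet> gradient f (x + t *\<^sub>R d) - t * (v \<bullet> (hessian f x *v d)) - C * t\<^sup>2 / 2"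
    for t :: real
  define h' where "h' t = v \<bullet> ((hessian f (x + t *\<^sub>R d) - hessian f x) *v d) - C * t" for t :: real
  have rate: "h' t \<le> 0" if "0 \<le> t" for t
  proof -
    let ?E = "hessian f (x + t *\<^sub>R d) - hessian f x"
    have "transpose (hessian f y) = hessian f y" for y
      using pd by (simp add: positive_definite_def)
    then have symE: "transpose ?E = ?E"
      by (auto simp: transpose_def vec_eq_iff)
    have "\<bar>u \<bullet> (?E *v u)\<bar> \<le> (M * (t * local_norm f x d)) * (u \<bullet> (hessian f w *v u))" for u
      using strongly_self_concordant_abs_form_diff_le[OF ssc, of u "x + t *\<^sub>R d" x x w] that
      by (simp add: local_norm_scaleR)
    from Cauchy_Schwarz_dominated_form[OF pd symE this, of v d]
    show ?thesis
      by (simp add: h'_def C_def local_norm_def mult_ac)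
  qed
  have grad: "(gradient f has_derivative (\<lambda>u. hessian f y *v u)) (at y)" for y
    using diff[of y] unfolding jacobian_works hessian_def .
  have deriv: "(h has_real_derivative h' t) (at t)" for t
  proof -
    have "((\<lambda>t. gradient f (x + t *\<^sub>R d)) has_derivative (\<lambda>s. hessian f (x + t *\<^sub>R d) *v (s *\<^sub>R d)))
        (at t)"
      by (rule has_derivative_compose[OF _ grad]) (auto intro!: derivative_eq_intros)
    then have "((\<lambda>t. v \<bullet> gradient f (x + t *\<^sub>R d)) has_derivative
        (\<lambda>s. v \<bullet> (hessian f (x + t *\<^sub>R d) *v (s *\<^sub>R d)))) (at t)"
      by (rule has_derivative_inner_right)
    then have "((\<lambda>t. v \<bullet> gradient f (x + t *\<^sub>R d)) has_real_derivative
        v \<bullet> (hessian f (x + t *\<^sub>R d) *v d)) (at t)"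
      unfolding has_field_derivative_def
      by (rule has_derivative_eq_rhs) (simp add: matrix_vector_mult_scaleR fun_eq_iff)
    then show ?thesis
      unfolding h_def h'_def
      by (auto intro!: derivative_eq_intros
          simp: matrix_vector_mult_diff_rdistrib inner_diff_right)
  qed
  have "h 1 \<le> h 0"
    using deriv rate by (intro DERIV_nonpos_imp_nonincreasing[of 0 1 h]) auto
  then show ?thesis
    by (simp add: h_def C_def inner_diff_right)
qed

lemma local_norm_end_point_le:
  assumes pd: "\<And>y. positive_definite (hessian f y)"
    and ssc: "strongly_self_concordant M f"
  shows "local_norm f (x + d) d \<le> sqrt (1 + M * local_norm f x d) * local_norm f x d"
proof -
  have "d \<bullet> (hessian f (x + d) *v d) \<le> (1 + M * local_norm f x d) * (d \<bullet> (hessian f x *v d))"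
    using strongly_self_concordant_form_diff_le[OF ssc, of d "x + d" x x x]
    by (simp add: local_norm_minus algebra_simps)
  then show ?thesis
    by (simp add: local_norm_def flip: real_sqrt_mult)
qed

text \<open>The linearisation error is measured in the local norm of the end point \<open>w = x + d\<close>, and
  \<open>v = H(w)\<inverse> \<nabla>f(w)\<close> makes \<open>v \<bullet> \<nabla>f(w)\<close> the squared decrement; the factor \<open>\<lambda>(w)\<close> that
  cancels may be zero, but then the claim is trivial.\<close>

lemma newton_step_decrement_le:
  fixes f :: "real^'n \<Rightarrow> real"
  assumes diff: "\<And>y. gradient f differentiable (at y)"
    and pd: "\<And>y. positive_definite (hessian f y)"
    and ssc: "strongly_self_concordant M f" and M: "0 < M"
  shows "newton_decrement f (x - matrix_inv (hessian f x) *v gradient f x)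
    \<le> M * sqrt (1 + M * newton_decrement f x) / 2 * (newton_decrement f x)\<^sup>2"
proof -
  define d where "d = - (matrix_inv (hessian f x) *v gradient f x)"
  define l where "l = newton_decrement f x"
  define l' where "l' = newton_decrement f (x + d)"
  define v where "v = matrix_inv (hessian f (x + d)) *v gradient f (x + d)"
  have d: "hessian f x *v d = - gradient f x"
    unfolding d_def
    using matrix_vector_mult_diff_distrib[of "hessian f x" 0]
    by (simp add: positive_definite_matrix_inv_mult[OF pd])
  have l: "l = local_norm f x d"
    by (simp add: l_def d_def newton_decrement_eq_local_norm[OF pd] local_norm_minus)
  have l': "l' = local_norm f (x + d) v"
    by (simp add: l'_def v_def newton_decrement_eq_local_norm[OF pd])
  have nonneg: "0 \<le> l" "0 \<le> l'"
    using local_norm_nonneg[OF pd] by (auto simp: l l')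
  have "l'\<^sup>2 = v \<bullet> gradient f (x + d)"
    by (simp add: l' local_norm_square[OF pd]) (simp add: v_def positive_definite_matrix_inv_mult[OF pd])
  also have "\<dots> \<le> M / 2 * l * l' * local_norm f (x + d) d"
    using gradient_linearisation_error[OF diff pd ssc, of v x d "x + d"] d l l' by simp
  also have "\<dots> \<le> M / 2 * l * l' * (sqrt (1 + M * l) * l)"
    using local_norm_end_point_le[OF pd ssc, of x d] nonneg M l by (intro mult_left_mono) auto
  finally have "l' * l' \<le> l' * (M * sqrt (1 + M * l) / 2 * l\<^sup>2)"
    by (simp add: power2_eq_square mult_ac)
  moreover have "0 \<le> M * sqrt (1 + M * l) / 2 * l\<^sup>2"
    using nonneg M by simp
  ultimately have "l' \<le> M * sqrt (1 + M * l) / 2 * l\<^sup>2"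
    using nonneg by (cases "l' = 0") (auto simp: mult_le_cancel_left)
  then show ?thesis
    by (simp add: l_def l'_def d_def)
qed

lemma sqrt_one_plus_le: "sqrt (1 + 2 * s) \<le> 1 + s" if "0 \<le> s" for s :: real
proof -
  have "1 + 2 * s \<le> (1 + s)\<^sup>2"
    by (simp add: power2_sum)
  then show ?thesis
    using that by (intro real_le_lsqrt) simp_all
qed

lemma one_plus_le_inverse_square: "1 + s \<le> 1 / (1 - s)\<^sup>2" if "0 \<le> s" "s < 1" for s :: real
proof -
  have "(1 + s) * (1 - s)\<^sup>2 = (1 - s\<^sup>2) * (1 - s)"
    by (simp add: power2_eq_square algebra_simps)
  also have "\<dots> \<le> 1"
    using that by (intro mult_le_one) (auto simp: power_le_one)
  finally show ?thesis
    using that by (simp add: pos_le_divide_eq)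
qed

theorem mainTheorem2:
  fixes f :: "real^'n \<Rightarrow> real" and M :: real
    and xstar :: "real^'n" and x :: "nat \<Rightarrow> real^'n"
  assumes "strictly_convex f"
    and "twice_differentiable f"
    and "bdd_below (range f)"
    and "\<forall>y. f xstar \<le> f y"
    and "\<forall>y. positive_definite (hessian f y)"
    and "M > 0"
    and "strongly_self_concordant M f"
    and "newton_sequence f x"
  shows "\<forall>k. newton_decrement f (x k) < 2 / M \<longrightarrow>
      newton_decrement f (x (Suc k))
        \<le> M * sqrt (1 + M * newton_decrement f (x k)) / 2 * (newton_decrement f (x k))\<^sup>2 \<and>
      M * sqrt (1 + M * newton_decrement f (x k)) / 2 * (newton_decrement f (x k))\<^sup>2
        \<le> (1 + M * newton_decrement f (x k) / 2) * (M * (newton_decrement f (x k))\<^sup>2 / 2) \<and>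
      (1 + M * newton_decrement f (x k) / 2) * (M * (newton_decrement f (x k))\<^sup>2 / 2)
        \<le> 1 / (1 - M / 2 * newton_decrement f (x k))\<^sup>2 * (M * (newton_decrement f (x k))\<^sup>2 / 2)"
proof (intro allI impI)
  fix k
  define l where "l = newton_decrement f (x k)"
  assume "newton_decrement f (x k) < 2 / M"
  then have s: "M * l / 2 < 1"
    using \<open>M > 0\<close> by (simp add: l_def field_simps)
  have pd: "positive_definite (hessian f y)" for y
    using assms by simp
  have "0 \<le> l"
    using local_norm_nonneg[OF pd] by (simp add: l_def newton_decrement_eq_local_norm[OF pd])
  then have s0: "0 \<le> M * l / 2"
    using \<open>M > 0\<close> by simp
  have q: "0 \<le> M * l\<^sup>2 / 2"
    using \<open>M > 0\<close> by simp
  have "gradient f differentiable (at y)" for y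
    using assms by (simp add: twice_differentiable_def)
  from newton_step_decrement_le[OF this pd \<open>strongly_self_concordant M f\<close> \<open>M > 0\<close>, of "x k"]
  have "newton_decrement f (x (Suc k)) \<le> M * sqrt (1 + M * l) / 2 * l\<^sup>2"
    using \<open>newton_sequence f x\<close> by (simp add: newton_sequence_def l_def)
  moreover have "M * sqrt (1 + M * l) / 2 * l\<^sup>2 \<le> (1 + M * l / 2) * (M * l\<^sup>2 / 2)"
    using mult_right_mono[OF sqrt_one_plus_le[OF s0] q] by (simp add: mult_ac)
  moreover have "(1 + M * l / 2) * (M * l\<^sup>2 / 2) \<le> 1 / (1 - M / 2 * l)\<^sup>2 * (M * l\<^sup>2 / 2)"
    using mult_right_mono[OF one_plus_le_inverse_square[OF s0 s] q] by simp
  ultimately show "newton_decrement f (x (Suc k))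
        \<le> M * sqrt (1 + M * newton_decrement f (x k)) / 2 * (newton_decrement f (x k))\<^sup>2 \<and>
      M * sqrt (1 + M * newton_decrement f (x k)) / 2 * (newton_decrement f (x k))\<^sup>2
        \<le> (1 + M * newton_decrement f (x k) / 2) * (M * (newton_decrement f (x k))\<^sup>2 / 2) \<and>
      (1 + M * newton_decrement f (x k) / 2) * (M * (newton_decrement f (x k))\<^sup>2 / 2)
        \<le> 1 / (1 - M / 2 * newton_decrement f (x k))\<^sup>2 * (M * (newton_decrement f (x k))\<^sup>2 / 2)"
    unfolding l_def by blast
qed

end
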